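(* Let $X,Y,Z,W$ be additive sets (finite non-empty subsets of a common abelian group), where $W$ is $3$-AP-free and $|X|=|Y|=|Z|=n$. Then \[\eta(3n)\ \ge\ \frac{1}{9}\,\mathbb{P}_{x\sim X,\,y\sim Y}\bigl(x+y\in Z\text{ and }x-y\in W\bigr),\] where $x$ and $y$ are chosen independently and uniformly at random from $X$ and $Y$ respectively.
   Context: For an integer $n\ge 1$, $\eta(n)$ denotes the maximum of $e(G)/n^2$ over all $n$-vertex (simple) graphs $G$ in which every edge belongs to exactly one triangle, where $e(G)$ is the number of edges of $G$. An additive set is $3$-AP-free if it does not contain any set of the form $\{x,x+d,x+2d\}$ with $d\neq 0$. *)

theory Defs
  imports "HOL-Probability.Probability"
begin

definition simple_graph :: "'v set \<Rightarrow> 'v set set \<Rightarrow> bool" where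
  "simple_graph V E \<longleftrightarrow> finite V \<and> (\<forall>e\<in>E. e \<subseteq> V \<and> card e = 2)"

definition triangle :: "'v set set \<Rightarrow> 'v set \<Rightarrow> bool" where
  "triangle E T \<longleftrightarrow> card T = 3 \<and> (\<forall>u\<in>T. \<forall>v\<in>T. u \<noteq> v \<longrightarrow> {u, v} \<in> E)"

definition each_edge_in_one_triangle :: "'v set set \<Rightarrow> bool" where
  "each_edge_in_one_triangle E \<longleftrightarrow> (\<forall>e\<in>E. \<exists>!T. triangle E T \<and> e \<subseteq> T)"

(* Every finite graph is isomorphic to one whose vertices are natural numbers,
   so restricting to the vertex type nat loses nothing. *)
definition eta_values :: "nat \<Rightarrow> real set" where
  "eta_values n = {real (card E) / (real n)\<^sup>2 | (V :: nat set) E.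
     simple_graph V E \<and> card V = n \<and> each_edge_in_one_triangle E}"

definition eta :: "nat \<Rightarrow> real" where
  "eta n = Max (eta_values n)"

(* The maximum defining eta is attained, so Max is meaningful. *)
lemma finite_eta_values: "finite (eta_values n)"
proof (rule finite_subset)
  show "eta_values n \<subseteq> (\<lambda>k. real k / (real n)\<^sup>2) ` {..2 ^ n}"
  proof
    fix r assume "r \<in> eta_values n"
    then obtain V :: "nat set" and E where
      r: "r = real (card E) / (real n)\<^sup>2" and g: "simple_graph V E" "card V = n"
      unfolding eta_values_def by blast
    have "finite V" "E \<subseteq> Pow V"
      using g(1) by (auto simp: simple_graph_def)
    then have "card E \<le> 2 ^ n"
      using card_mono[of "Pow V" E] g(2) by (simp add: card_Pow)
    then show "r \<in> (\<lambda>k. real k / (real n)\<^sup>2) ` {..2 ^ n}"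
      using r by blast
  qed
qed simp

lemma eta_values_nonempty: "eta_values n \<noteq> {}"
proof -
  have "simple_graph {..<n} {}" "card {..<n} = n" "each_edge_in_one_triangle ({} :: nat set set)"
    by (simp_all add: simple_graph_def each_edge_in_one_triangle_def)
  then show ?thesis
    unfolding eta_values_def by blast
qed

definition additive_set :: "'a::ab_group_add set \<Rightarrow> bool" where
  "additive_set A \<longleftrightarrow> finite A \<and> A \<noteq> {}"

(* The progression may degenerate: x + 2d = x is allowed when d has order two. *)
definition three_AP_free :: "'a::ab_group_add set \<Rightarrow> bool" where
  "three_AP_free A \<longleftrightarrow> \<not> (\<exists>x d. d \<noteq> 0 \<and> {x, x + d, x + (d + d)} \<subseteq> A)"

end

theory Submission imports Defs begin

text \<open>
  Let \<open>S\<close> be the set of pairs \<open>(x, y)\<close> in \<open>X \<times> Y\<close> with \<open>x + y \<in> Z\<close> and \<open>x - y \<in> W\<close>.  On the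
  disjoint union of \<open>X\<close>, \<open>Y\<close>, \<open>Z\<close>, which has \<open>3n\<close> vertices, take the union of the triangles with
  vertices \<open>x \<in> X\<close>, \<open>y \<in> Y\<close>, \<open>x + y \<in> Z\<close> for \<open>(x, y) \<in> S\<close>.  Any two vertices of such a triangle
  determine the third, so these triangles are edge-disjoint
  (lemma \<open>sum_triple_linear\<close>).

  There is no other triangle.  A triangle of this tripartite graph has vertices \<open>x\<close>, \<open>y\<close>, \<open>z\<close> in
  the three parts, and its edges come from pairs \<open>(x, y)\<close>, \<open>(x, y')\<close>, \<open>(x', y)\<close> of \<open>S\<close> with
  \<open>z = x + y' = x' + y\<close>.  Then \<open>x - y'\<close>, \<open>x - y\<close>, \<open>x' - y\<close> lie in \<open>W\<close> and form an arithmetic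
  progression with difference \<open>y' - y\<close>.  As \<open>W\<close> is 3-AP-free, \<open>y' = y\<close>, so the triangle is the one
  that belongs to \<open>(x, y)\<close> (lemma \<open>triangle_is_sum_triple\<close>).  Division by 2 is not needed, since
  3-AP-freeness also excludes progressions with a difference of order two.

  Hence every edge is in exactly one triangle and there are \<open>3 * card S\<close> edges.  By
  lemma \<open>eta_ge_triple_system\<close>,
  \<open>\<eta>(3n) \<ge> 3 * card S / (3n)\<^sup>2\<close>, which is a third of the probability in question and so
  more than is needed.
\<close>

text \<open>The graph whose edges are the pairs contained in some member of a family of sets.\<close>

definition shadow :: "'v set set \<Rightarrow> 'v set set" where
  "shadow F = {e. card e = 2 \<and> (\<exists>T\<in>F. e \<subseteq> T)}"

lemma member_is_triangle_of_shadow: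
  assumes "T \<in> F" "card T = 3"
  shows "triangle (shadow F) T"
  using assms by (auto simp: triangle_def shadow_def card_2_iff)

lemma card_shadow:
  assumes "finite F" "\<And>T. T \<in> F \<Longrightarrow> card T = 3"
    and linear: "\<And>T T' e. \<lbrakk>T \<in> F; T' \<in> F; card e = 2; e \<subseteq> T; e \<subseteq> T'\<rbrakk> \<Longrightarrow> T = T'"
  shows "card (shadow F) = 3 * card F"
proof -
  have fin: "finite T" if "T \<in> F" for T
    using assms(2)[OF that] by (metis card.infinite zero_neq_numeral)
  have "shadow F = (\<Union>T\<in>F. {e. e \<subseteq> T \<and> card e = 2})"
    by (auto simp: shadow_def)
  also have "card \<dots> = (\<Sum>T\<in>F. card {e. e \<subseteq> T \<and> card e = 2})"
    using assms(1) fin by (intro card_UN_disjoint) (auto dest: linear)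
  also have "\<dots> = (\<Sum>T\<in>F. 3)"
    using fin assms(2) by (intro sum.cong) (simp_all add: n_subsets choose_two)
  finally show ?thesis by simp
qed

text \<open>
  A linear triple system (two triples share at most one vertex) whose shadow contains no triangles
  besides the triples bounds \<open>eta\<close> from below.
\<close>

lemma eta_ge_triple_system:
  fixes V :: "nat set"
  assumes "finite V" and sub: "\<And>T. T \<in> F \<Longrightarrow> T \<subseteq> V" and card3: "\<And>T. T \<in> F \<Longrightarrow> card T = 3"
    and linear: "\<And>T T' e. \<lbrakk>T \<in> F; T' \<in> F; card e = 2; e \<subseteq> T; e \<subseteq> T'\<rbrakk> \<Longrightarrow> T = T'"
    and no_other: "\<And>T. triangle (shadow F) T \<Longrightarrow> T \<in> F"
  shows "eta (card V) \<ge> 3 * real (card F) / (real (card V))\<^sup>2"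
proof -
  have "finite F"
    using sub \<open>finite V\<close> by (intro finite_subset[of F "Pow V"]) auto
  then have card: "card (shadow F) = 3 * card F"
    using card3 linear by (rule card_shadow)
  have simple: "simple_graph V (shadow F)"
    using \<open>finite V\<close> sub by (fastforce simp: simple_graph_def shadow_def)
  have one: "each_edge_in_one_triangle (shadow F)"
    unfolding each_edge_in_one_triangle_def
  proof
    fix e assume "e \<in> shadow F"
    then obtain T where T: "card e = 2" "T \<in> F" "e \<subseteq> T"
      by (auto simp: shadow_def)
    show "\<exists>!T. triangle (shadow F) T \<and> e \<subseteq> T"
    proof (rule ex1I[of _ T])
      show "triangle (shadow F) T \<and> e \<subseteq> T"
        using T card3 by (simp add: member_is_triangle_of_shadow)
      show "T' = T" if "triangle (shadow F) T' \<and> e \<subseteq> T'" for T'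
        using that T no_other linear by blast
    qed
  qed
  have "real (card (shadow F)) / (real (card V))\<^sup>2 \<in> eta_values (card V)"
    unfolding eta_values_def using simple one by blast
  then have "real (card (shadow F)) / (real (card V))\<^sup>2 \<le> eta (card V)"
    unfolding eta_def by (intro Max_ge finite_eta_values)
  then show ?thesis by (simp add: card)
qed

lemma three_AP_freeD:
  assumes "three_AP_free W" "x \<in> W" "x + d \<in> W" "x + (d + d) \<in> W"
  shows "d = 0"
  using assms by (auto simp: three_AP_free_def)

text \<open>
  The triple \<open>x\<close>, \<open>y\<close>, \<open>x + y\<close> of the pair \<open>p = (x, y)\<close>, encoded in the natural numbers by a map \<open>f\<close>
  that is injective on the elements in question.  An element \<open>v\<close> of the group is represented by the three
  numbers \<open>3 * f v\<close>, \<open>3 * f v + 1\<close>, \<open>3 * f v + 2\<close>, which are its copies in the three parts, so that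
  the part of a vertex is its residue modulo 3.
\<close>

definition sum_triple :: "('a::ab_group_add \<Rightarrow> nat) \<Rightarrow> 'a \<times> 'a \<Rightarrow> nat set" where
  "sum_triple f p = {3 * f (fst p), 3 * f (snd p) + 1, 3 * f (fst p + snd p) + 2}"

lemma sum_triple_mod_cases:
  assumes "v \<in> sum_triple f (x, y)"
  shows "v mod 3 = 0 \<Longrightarrow> v = 3 * f x" "v mod 3 = 1 \<Longrightarrow> v = 3 * f y + 1"
    "v mod 3 = 2 \<Longrightarrow> v = 3 * f (x + y) + 2"
  using assms unfolding sum_triple_def by (auto; presburger)+

lemma card_sum_triple: "card (sum_triple f p) = 3"
proof -
  have "3 * a \<noteq> 3 * b + 1" "3 * a \<noteq> 3 * b + 2" "3 * a + 1 \<noteq> 3 * b + 2" for a b :: nat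
    by presburger+
  then show ?thesis by (simp add: sum_triple_def)
qed

lemma inj_on_mod_sum_triple: "inj_on (\<lambda>v. v mod 3) (sum_triple f p)"
  by (auto simp: sum_triple_def inj_on_def mod_Suc)

text \<open>Two coordinates of \<open>(x, y, x + y)\<close> determine the third.\<close>

lemma sum_triple_linear:
  assumes inj: "inj_on f U"
    and p: "fst p \<in> U" "snd p \<in> U" "fst p + snd p \<in> U"
    and q: "fst q \<in> U" "snd q \<in> U" "fst q + snd q \<in> U"
    and e: "card e = 2" "e \<subseteq> sum_triple f p" "e \<subseteq> sum_triple f q"
  shows "p = q"
proof -
  obtain x y x' y' where pq: "p = (x, y)" "q = (x', y')"
    by (metis surj_pair)
  have f_eq: "a = b" if "f a = f b" "a \<in> U" "b \<in> U" for a b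
    using inj that by (auto dest: inj_onD)
  obtain u v where uv: "e = {u, v}" "u \<noteq> v"
    using e(1) by (auto simp: card_2_iff)
  have ne: "u mod 3 \<noteq> v mod 3"
    using inj_on_mod_sum_triple[of f p] e(2) uv by (auto dest: inj_onD)
  have eqs: "w mod 3 = 0 \<Longrightarrow> x = x'" "w mod 3 = 1 \<Longrightarrow> y = y'" "w mod 3 = 2 \<Longrightarrow> x + y = x' + y'"
    if "w \<in> e" for w
  proof -
    have w: "w \<in> sum_triple f (x, y)" "w \<in> sum_triple f (x', y')"
      using that e pq by auto
    show "w mod 3 = 0 \<Longrightarrow> x = x'" "w mod 3 = 1 \<Longrightarrow> y = y'" "w mod 3 = 2 \<Longrightarrow> x + y = x' + y'"
      using sum_triple_mod_cases[OF w(1)] sum_triple_mod_cases[OF w(2)] p q pq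
      by (auto intro!: f_eq)
  qed
  have "u mod 3 \<in> {0, 1, 2}" "v mod 3 \<in> {0, 1, 2}" by auto
  then have "x = x' \<and> y = y'"
    using ne eqs[of u] eqs[of v] uv(1) by auto
  then show ?thesis by (simp add: pq)
qed

text \<open>
  The only place where 3-AP-freeness enters: a triangle of the shadow of the triples is a triple.
\<close>

lemma triangle_is_sum_triple:
  assumes inj: "inj_on f U" and free: "three_AP_free W"
    and S: "\<And>x y. (x, y) \<in> S \<Longrightarrow> x \<in> U \<and> y \<in> U \<and> x + y \<in> U \<and> x - y \<in> W"
    and T: "triangle (shadow (sum_triple f ` S)) T"
  shows "T \<in> sum_triple f ` S"
proof -
  have f_eq: "a = b" if "f a = f b" "a \<in> U" "b \<in> U" for a b
    using inj that by (auto dest: inj_onD)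
  have cT: "card T = 3" and finT: "finite T"
    using T by (auto simp: triangle_def intro: card_ge_0_finite)
  have edge: "\<exists>x y. (x, y) \<in> S \<and> u \<in> sum_triple f (x, y) \<and> v \<in> sum_triple f (x, y)"
    if "u \<in> T" "v \<in> T" "u \<noteq> v" for u v
    using T that by (fastforce simp: triangle_def shadow_def)
  \<comment> \<open>Adjacent vertices lie in different parts, so \<open>T\<close> has one vertex in each part.\<close>
  have "inj_on (\<lambda>v. v mod 3) T"
  proof (rule inj_onI, rule ccontr)
    fix u v assume uv: "u \<in> T" "v \<in> T" "u mod 3 = v mod 3" "u \<noteq> v"
    then obtain x y where "u \<in> sum_triple f (x, y)" "v \<in> sum_triple f (x, y)"
      using edge by blast
    then show False
      using uv inj_on_mod_sum_triple[of f "(x, y)"] by (auto dest: inj_onD)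
  qed
  then have "card ((\<lambda>v. v mod 3) ` T) = 3"
    by (simp add: card_image cT)
  moreover have "(\<lambda>v. v mod 3) ` T \<subseteq> {0, 1, 2}" by auto
  ultimately have "(\<lambda>v. v mod 3) ` T = {0, 1, 2}"
    by (intro card_subset_eq) auto
  then have "\<exists>v\<in>T. v mod 3 = k" if "k \<in> {0, 1, 2}" for k
    using that by (metis (lifting) imageE)
  then obtain p q r where pqr: "p \<in> T" "q \<in> T" "r \<in> T" "p mod 3 = 0" "q mod 3 = 1" "r mod 3 = 2"
    by (meson insertI1 insertI2)
  then have ne: "p \<noteq> q" "p \<noteq> r" "q \<noteq> r" by auto
  have "{p, q, r} = T"
    using pqr ne finT cT by (intro card_subset_eq) auto
  obtain x y where xy: "(x, y) \<in> S" "p \<in> sum_triple f (x, y)" "q \<in> sum_triple f (x, y)"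
    using edge pqr ne by blast
  obtain x1 y' where xy1: "(x1, y') \<in> S" "p \<in> sum_triple f (x1, y')" "r \<in> sum_triple f (x1, y')"
    using edge pqr ne by blast
  obtain x' y1 where xy2: "(x', y1) \<in> S" "q \<in> sum_triple f (x', y1)" "r \<in> sum_triple f (x', y1)"
    using edge pqr ne by blast
  have p: "p = 3 * f x" "p = 3 * f x1"
    using sum_triple_mod_cases(1)[OF xy(2)] sum_triple_mod_cases(1)[OF xy1(2)] pqr by auto
  have q: "q = 3 * f y + 1" "q = 3 * f y1 + 1"
    using sum_triple_mod_cases(2)[OF xy(3)] sum_triple_mod_cases(2)[OF xy2(2)] pqr by auto
  have r: "r = 3 * f (x1 + y') + 2" "r = 3 * f (x' + y1) + 2"
    using sum_triple_mod_cases(3)[OF xy1(3)] sum_triple_mod_cases(3)[OF xy2(3)] pqr by auto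
  have x1: "x1 = x" using p S xy xy1 by (auto intro!: f_eq)
  have y1: "y1 = y" using q S xy xy2 by (auto intro!: f_eq)
  have z: "x + y' = x' + y"
    using r S[OF xy1(1)] S[OF xy2(1)] x1 y1 by (auto intro!: f_eq)
  have "x - y' + (y' - y) \<in> W"
    using S[OF xy(1)] by simp
  moreover have "x - y' + ((y' - y) + (y' - y)) = x' - y"
    using z by (simp add: algebra_simps)
  moreover have "x - y' \<in> W" "x' - y \<in> W"
    using S[OF xy1(1)] S[OF xy2(1)] x1 y1 by auto
  ultimately have "y' - y = 0"
    using free by (metis three_AP_freeD)
  then have "T = sum_triple f (x, y)"
    using \<open>{p, q, r} = T\<close> p q r x1 by (simp add: sum_triple_def)
  then show ?thesis using xy(1) by blast
qed

theorem proposition1p2: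
  fixes X Y Z W :: "'a::ab_group_add set" and n :: nat
  assumes "additive_set X" and "additive_set Y" and "additive_set Z" and "additive_set W"
    and "three_AP_free W"
    and "card X = n" and "card Y = n" and "card Z = n"
  shows "eta (3 * n) \<ge> 1 / 9 *
    measure_pmf.prob (pair_pmf (pmf_of_set X) (pmf_of_set Y)) {(x, y). x + y \<in> Z \<and> x - y \<in> W}"
proof -
  have fin: "finite X" "finite Y" "finite Z" and nonempty: "X \<noteq> {}" "Y \<noteq> {}"
    using assms by (auto simp: additive_set_def)
  define U where "U = X \<union> Y \<union> Z"
  define S where "S = (X \<times> Y) \<inter> {(x, y). x + y \<in> Z \<and> x - y \<in> W}"
  have "finite U" using fin by (simp add: U_def)
  then obtain f :: "'a \<Rightarrow> nat" where f: "inj_on f U"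
    using finite_imp_inj_to_nat_seg by blast
  define V where "V = (\<lambda>v. 3 * f v) ` X \<union> ((\<lambda>v. 3 * f v + 1) ` Y \<union> (\<lambda>v. 3 * f v + 2) ` Z)"
  have finV: "finite V" using fin by (simp add: V_def)
  have inj: "inj_on f X" "inj_on f Y" "inj_on f Z"
    using f by (auto simp: U_def intro: inj_on_subset)
  have "card ((\<lambda>v. 3 * f v) ` X) = n" "card ((\<lambda>v. 3 * f v + 1) ` Y) = n"
    "card ((\<lambda>v. 3 * f v + 2) ` Z) = n"
    using inj assms(6-8) by (subst card_image; auto simp: inj_on_def)+
  moreover have "3 * a \<noteq> 3 * b + 1" "3 * a \<noteq> 3 * b + 2" "3 * a + 1 \<noteq> 3 * b + 2" for a b :: nat
    by presburger+
  ultimately have cardV: "card V = 3 * n"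
    unfolding V_def using fin by (subst card_Un_disjoint; (subst card_Un_disjoint)?; auto)
  have linear: "p = q" if "p \<in> S" "q \<in> S" "card e = 2" "e \<subseteq> sum_triple f p" "e \<subseteq> sum_triple f q"
    for p q e
    using that by (intro sum_triple_linear[OF f]) (auto simp: S_def U_def)
  have "inj_on (sum_triple f) S"
  proof (rule inj_onI)
    fix p q assume pq: "p \<in> S" "q \<in> S" "sum_triple f p = sum_triple f q"
    obtain e where "e \<subseteq> sum_triple f p" "card e = 2"
      using obtain_subset_with_card_n[of 2 "sum_triple f p"] by (auto simp: card_sum_triple)
    then show "p = q" using pq linear by metis
  qed
  then have cardF: "card (sum_triple f ` S) = card S" by (rule card_image)
  have bound: "3 * real (card S) / (real (3 * n))\<^sup>2 \<le> eta (3 * n)"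
    unfolding cardV[symmetric] cardF[symmetric]
  proof (rule eta_ge_triple_system)
    show "T \<subseteq> V" if "T \<in> sum_triple f ` S" for T
      using that by (auto simp: S_def V_def sum_triple_def)
    show "card T = 3" if "T \<in> sum_triple f ` S" for T
      using that by (auto simp: card_sum_triple)
    show "T = T'" if "T \<in> sum_triple f ` S" "T' \<in> sum_triple f ` S" "card e = 2" "e \<subseteq> T" "e \<subseteq> T'"
      for T T' e
      using that linear by blast
    show "T \<in> sum_triple f ` S" if "triangle (shadow (sum_triple f ` S)) T" for T
      using f assms(5) _ that by (rule triangle_is_sum_triple) (auto simp: S_def U_def)
  qed (rule finV)
  have "pair_pmf (pmf_of_set X) (pmf_of_set Y) = pmf_of_set (X \<times> Y)"
    by (intro pmf_eqI) (auto simp: pmf_pair fin nonempty indicator_def)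
  then have "measure_pmf.prob (pair_pmf (pmf_of_set X) (pmf_of_set Y))
      {(x, y). x + y \<in> Z \<and> x - y \<in> W} = real (card S) / (real n)\<^sup>2"
    using fin nonempty assms(6,7)
    by (simp add: measure_pmf_of_set S_def card_cartesian_product power2_eq_square)
  moreover have "3 * real (card S) / (real (3 * n))\<^sup>2 = 1 / 3 * (real (card S) / (real n)\<^sup>2)"
    by (simp add: power2_eq_square)
  moreover have "0 \<le> real (card S) / (real n)\<^sup>2" by simp
  ultimately show ?thesis using bound by linarith
qed

end
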